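(* Let $A\in\mathcal{M}_{m,n}$, $r=\mathrm{rank}(A)$, $q=\min\{m,n\}$ and let $q'$ be an integer with $r\leq q'\leq q$. Let $\{f_1,\ldots,f_{q'-r}\}$ be an orthonormal subset of $\mathrm{N}(A)$ and $\{g_1,\ldots,g_{q'-r}\}$ be an orthonormal subset of $\mathrm{N}(A^{*})$. Let $\{d_k\}_{k=1}^{q'-r}\subset\mathbb{F}\setminus\{0\}$. Then $$A^{\dagger}=\left(A+\sum_{k=1}^{q'-r}d_kg_kf_k^{*}\right)^{\dagger}-\sum_{k=1}^{q'-r}\frac{1}{d_k}f_kg_k^{*}.$$
   Context: $\mathbb{F}=\mathbb{R}$ or $\mathbb{F}=\mathbb{C}$; $\mathcal{M}_{m,n}$ is the set of $m\times n$ matrices over $\mathbb{F}$; vectors in $\mathbb{F}^n$ are column vectors; $A^{*}$ is the conjugate transpose and $\mathrm{N}(A)$ the null space of $A$. $A^{\dagger}$ is the Moore--Penrose inverse: the unique matrix $X$ with $AXA=A$, $XAX=X$, $(AX)^{*}=AX$, $(XA)^{*}=XA$. *)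

theory Defs
  imports "HOL-Analysis.Analysis" "Jordan_Normal_Form.Conjugate"
begin

text \<open>
  All notions are polymorphic in a field with conjugation; \<^const>\<open>conjugate\<close> is the identity on
  \<^typ>\<open>real\<close> and complex conjugation on \<^typ>\<open>complex\<close>.  A matrix with m rows and n columns has type
  \<open>'a^'n^'m\<close>.
\<close>

definition conj_transpose :: "'a::conjugatable_field^'n^'m \<Rightarrow> 'a^'m^'n" where
  "conj_transpose A = (\<chi> i j. conjugate (A $ j $ i))"

definition null_space :: "'a::field^'n^'m \<Rightarrow> ('a^'n) set" where
  "null_space A = {x. A *v x = 0}"

text \<open>
  The library's \<^const>\<open>inner\<close> on complex vectors is only the real part of the product below, so it
  cannot be used to express orthogonality over the complex numbers.
\<close>

definition cinner :: "'a::conjugatable_field^'n \<Rightarrow> 'a^'n \<Rightarrow> 'a" where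
  "cinner x y = (\<Sum>i\<in>UNIV. x $ i * conjugate (y $ i))"

definition orthonormal_family :: "'i set \<Rightarrow> ('i \<Rightarrow> 'a::conjugatable_field^'n) \<Rightarrow> bool" where
  "orthonormal_family I f \<longleftrightarrow>
     (\<forall>i\<in>I. \<forall>j\<in>I. cinner (f i) (f j) = (if i = j then 1 else 0))"

definition mat_scale :: "'a::field \<Rightarrow> 'a^'n^'m \<Rightarrow> 'a^'n^'m"  (infixr "*\<^sub>m" 75) where
  "c *\<^sub>m A = (\<chi> i j. c * A $ i $ j)"

text \<open>The m-by-n matrix \<open>x y\<^sup>*\<close>, with \<open>x\<close> and \<open>y\<close> read as one-column matrices.\<close>

definition outer :: "'a::conjugatable_field^'m \<Rightarrow> 'a^'n \<Rightarrow> 'a^'n^'m" where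
  "outer x y = (columnvector x :: 'a^1^'m) ** conj_transpose (columnvector y :: 'a^1^'n)"

lemma outer_nth: "outer x y $ i $ j = x $ i * conjugate (y $ j)"
  by (simp add: outer_def conj_transpose_def columnvector_def matrix_matrix_mult_def)

definition is_mp_inverse :: "'a::conjugatable_field^'n^'m \<Rightarrow> 'a^'m^'n \<Rightarrow> bool" where
  "is_mp_inverse A X \<longleftrightarrow>
     A ** X ** A = A \<and> X ** A ** X = X \<and>
     conj_transpose (A ** X) = A ** X \<and> conj_transpose (X ** A) = X ** A"

definition mp_inverse :: "'a::conjugatable_field^'n^'m \<Rightarrow> 'a^'m^'n" where
  "mp_inverse A = (THE X. is_mp_inverse A X)"

end

theory Submission
  imports Defs
begin

text \<open>
  Write \<open>D = \<Sum> d\<^sub>k g\<^sub>k f\<^sub>k\<^sup>*\<close> and \<open>E = \<Sum> d\<^sub>k\<^sup>-\<^sup>1 f\<^sub>k g\<^sub>k\<^sup>*\<close>.  By orthonormality \<open>E\<close> is the Moore--Penrose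
  inverse of \<open>D\<close>.  The null space conditions say that \<open>A D\<^sup>* = 0\<close> and \<open>A\<^sup>* D = 0\<close>, so all mixed
  products between \<open>A\<close>, its inverse, \<open>D\<close> and \<open>E\<close> vanish and the Penrose equations of the two
  pairs add up to those of \<open>A + D\<close>.
\<close>

section \<open>Algebra of matrices, adjoints and rank-one products\<close>

lemma matrix_add_rdistrib: "(A + B) ** C = A ** C + B ** C"
  for A B :: "'a::semiring_1^'n^'m"
  by (simp add: vec_eq_iff matrix_matrix_mult_def sum.distrib distrib_right)

lemma matrix_mult_zero_left [simp]: "0 ** A = (0 :: 'a::semiring_1^'n^'m)"
  by (simp add: vec_eq_iff matrix_matrix_mult_def)

lemma matrix_mult_zero_right [simp]: "A ** 0 = (0 :: 'a::semiring_1^'n^'m)"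
  by (simp add: vec_eq_iff matrix_matrix_mult_def)

lemma matrix_diff_ldistrib: "A ** (B - C) = A ** B - A ** C"
  for A :: "'a::ring_1^'n^'m"
  by (simp add: vec_eq_iff matrix_matrix_mult_def sum_subtractf right_diff_distrib)

lemma matrix_sum_ldistrib: "A ** (\<Sum>i\<in>I. B i) = (\<Sum>i\<in>I. A ** B i)"
  for A :: "'a::semiring_1^'n^'m"
  by (induction I rule: infinite_finite_induct) (simp_all add: matrix_add_ldistrib)

lemma matrix_sum_rdistrib: "(\<Sum>i\<in>I. B i) ** A = (\<Sum>i\<in>I. B i ** A)"
  for A :: "'a::semiring_1^'n^'m"
  by (induction I rule: infinite_finite_induct) (simp_all add: matrix_add_rdistrib)

lemma conj_transpose_invol [simp]: "conj_transpose (conj_transpose A) = A"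
  by (simp add: conj_transpose_def vec_eq_iff)

lemma conj_transpose_zero [simp]: "conj_transpose 0 = 0"
  by (simp add: conj_transpose_def vec_eq_iff)

lemma conj_transpose_add: "conj_transpose (A + B) = conj_transpose A + conj_transpose B"
  by (simp add: conj_transpose_def vec_eq_iff conjugate_dist_add)

lemma conj_transpose_mult: "conj_transpose (A ** B) = conj_transpose B ** conj_transpose A"
  by (simp add: conj_transpose_def matrix_matrix_mult_def vec_eq_iff sum_conjugate
      conjugate_dist_mul mult.commute)

lemma conj_transpose_sum: "conj_transpose (\<Sum>i\<in>I. A i) = (\<Sum>i\<in>I. conj_transpose (A i))"
  by (induction I rule: infinite_finite_induct) (simp_all add: conj_transpose_add)

lemma conj_transpose_outer [simp]: "conj_transpose (outer x y) = outer y x"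
  by (simp add: conj_transpose_def outer_nth vec_eq_iff conjugate_dist_mul mult.commute)

lemma mat_scale_mult_left: "(c *\<^sub>m A) ** B = c *\<^sub>m (A ** B)"
  by (simp add: mat_scale_def matrix_matrix_mult_def vec_eq_iff sum_distrib_left mult.assoc)

lemma mat_scale_mult_right: "A ** (c *\<^sub>m B) = c *\<^sub>m (A ** B)"
  by (simp add: mat_scale_def matrix_matrix_mult_def vec_eq_iff sum_distrib_left mult.left_commute)

lemma mat_scale_scale [simp]: "a *\<^sub>m b *\<^sub>m A = (a * b) *\<^sub>m A"
  by (simp add: mat_scale_def vec_eq_iff mult.assoc)

lemma mat_scale_one [simp]: "1 *\<^sub>m A = A"
  by (simp add: mat_scale_def vec_eq_iff)

lemma mat_scale_zero_left [simp]: "0 *\<^sub>m A = 0"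
  by (simp add: mat_scale_def vec_eq_iff)

lemma mat_scale_zero_right [simp]: "c *\<^sub>m 0 = 0"
  by (simp add: mat_scale_def vec_eq_iff)

text \<open>The middle factor of \<open>a b* c d*\<close> is the scalar \<open>b* c\<close>, which
  is \<open>cinner c b\<close> because \<open>cinner\<close> conjugates its second argument.\<close>

lemma outer_mult_outer: "outer a b ** outer c d = cinner c b *\<^sub>m outer a d"
  by (simp add: matrix_matrix_mult_def vec_eq_iff outer_nth mat_scale_def cinner_def
      sum_distrib_left sum_distrib_right mult_ac)

lemma mult_outer_null_space:
  assumes "x \<in> null_space A"
  shows "A ** outer x y = 0"
proof -
  have "(A ** outer x y) $ i $ j = (A *v x) $ i * conjugate (y $ j)" for i j
    by (simp add: matrix_matrix_mult_def matrix_vector_mult_def outer_nth sum_distrib_right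
        mult.assoc)
  with assms show ?thesis
    by (simp add: null_space_def vec_eq_iff)
qed

text \<open>Orthonormality of the inner family \<open>f\<close> leaves only the diagonal of the
  double sum. The outer families and the coefficients stay free, so that the same rule also
  evaluates triple products.\<close>

lemma outer_sum_mult_outer_sum:
  assumes "orthonormal_family I f" "finite I"
  shows "(\<Sum>k\<in>I. d k *\<^sub>m outer (g k) (f k)) ** (\<Sum>k\<in>I. e k *\<^sub>m outer (f k) (h k)) =
    (\<Sum>k\<in>I. (d k * e k) *\<^sub>m outer (g k) (h k))"
proof -
  have "(\<Sum>k\<in>I. d k *\<^sub>m outer (g k) (f k)) ** (\<Sum>k\<in>I. e k *\<^sub>m outer (f k) (h k)) =
      (\<Sum>k\<in>I. \<Sum>l\<in>I. (d k *\<^sub>m outer (g k) (f k)) ** (e l *\<^sub>m outer (f l) (h l)))"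
    by (subst matrix_sum_rdistrib) (simp add: matrix_sum_ldistrib)
  also have "\<dots> = (\<Sum>k\<in>I. \<Sum>l\<in>I. if l = k then (d k * e k) *\<^sub>m outer (g k) (h k) else 0)"
    using assms(1) by (intro sum.cong refl)
      (simp add: mat_scale_mult_left mat_scale_mult_right outer_mult_outer
        orthonormal_family_def mult_ac)
  also have "\<dots> = (\<Sum>k\<in>I. (d k * e k) *\<^sub>m outer (g k) (h k))"
    using assms(2) by simp
  finally show ?thesis .
qed

section \<open>Existence and uniqueness of the Moore-Penrose inverse\<close>

text \<open>Each diagonal entry of \<open>A* A\<close> is the sum of the squared moduli in one
  column of \<open>A\<close>, and a sum of nonnegative terms vanishes only termwise.\<close>

lemma conj_transpose_mult_self_eq_zero:
  fixes A :: "'a::conjugatable_ordered_field^'n^'m"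
  assumes "conj_transpose A ** A = 0"
  shows "A = 0"
proof -
  have "A $ i $ j = 0" for i j
  proof -
    have "(\<Sum>i\<in>UNIV. A $ i $ j * conjugate (A $ i $ j)) = (conj_transpose A ** A) $ j $ j"
      by (simp add: matrix_matrix_mult_def conj_transpose_def mult.commute)
    also have "\<dots> = 0"
      using assms by simp
    finally have "A $ i $ j * conjugate (A $ i $ j) = 0"
      by (subst (asm) sum_nonneg_eq_0_iff) (auto intro: conjugate_square_positive)
    then show ?thesis
      by simp
  qed
  then show ?thesis
    by (simp add: vec_eq_iff)
qed

text \<open>Take for \<open>G\<close> the matrix of a linear map that picks a preimage for every
  vector in the range of \<open>A\<close>.\<close>

lemma ex_generalized_inverse:
  fixes A :: "'a::field^'n^'m"
  shows "\<exists>G. A ** G ** A = A"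
proof -
  obtain g where g: "Vector_Spaces.linear (*s) (*s) g" "\<And>x. A *v g (A *v x) = A *v x"
    using vec.linear_exists_right_inverse_on[of "(*v) A" UNIV]
    by (metis UNIV_I image_eqI matrix_vector_mul_linear_gen vec.subspace_UNIV)
  have "(A ** matrix g ** A) *v x = A *v x" for x
    using g by (simp add: matrix_vector_mul_assoc[symmetric] matrix_works)
  then show ?thesis
    by (metis matrix_eq)
qed

text \<open>
  If \<open>G\<close> is any generalized inverse of \<open>A\<^sup>* A\<close>, then \<open>P = A G A\<^sup>*\<close> satisfies \<open>P A = A\<close> by positive
  definiteness; hence \<open>P P\<^sup>* = P\<^sup>*\<close>, which makes \<open>P\<close> Hermitian.
\<close>
lemma ex_hermitian_generalized_inverse:
  fixes A :: "'a::conjugatable_ordered_field^'n^'m"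
  shows "\<exists>B. A ** B ** A = A \<and> conj_transpose (A ** B) = A ** B"
proof -
  let ?H = "conj_transpose A ** A"
  obtain G where G: "?H ** G ** ?H = ?H"
    using ex_generalized_inverse by blast
  define P where "P = A ** (G ** conj_transpose A)"
  have "P ** A - A = A ** (G ** ?H - mat 1)"
    by (simp add: P_def matrix_diff_ldistrib matrix_mul_assoc)
  then have "conj_transpose (P ** A - A) ** (P ** A - A) =
      conj_transpose (G ** ?H - mat 1) ** (?H ** (G ** ?H - mat 1))"
    by (simp add: conj_transpose_mult matrix_mul_assoc)
  also have "?H ** (G ** ?H - mat 1) = 0"
    using G by (simp add: matrix_diff_ldistrib matrix_mul_assoc)
  finally have "conj_transpose (P ** A - A) ** (P ** A - A) = 0"
    by simp
  then have PA: "P ** A = A"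
    using conj_transpose_mult_self_eq_zero by force
  have "P ** conj_transpose P = P ** A ** (conj_transpose G ** conj_transpose A)"
    by (simp add: P_def conj_transpose_mult matrix_mul_assoc)
  also have "\<dots> = conj_transpose P"
    by (simp add: PA) (simp add: P_def conj_transpose_mult matrix_mul_assoc)
  finally have "conj_transpose P = P"
    by (metis conj_transpose_invol conj_transpose_mult)
  with PA show ?thesis
    unfolding P_def by blast
qed

text \<open>One generalized inverse \<open>B\<close> makes \<open>A B\<close> Hermitian; another,
  \<open>C\<close>, found by passing to the adjoint of \<open>A\<close>, makes \<open>C A\<close>
  Hermitian. The product \<open>X = C A B\<close> has both properties, since
  \<open>A X = A B\<close> and \<open>X A = C A\<close>.\<close>

lemma ex_mp_inverse:
  fixes A :: "'a::conjugatable_ordered_field^'n^'m"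
  shows "\<exists>X. is_mp_inverse A X"
proof -
  obtain B where B: "A ** B ** A = A" "conj_transpose (A ** B) = A ** B"
    using ex_hermitian_generalized_inverse by blast
  obtain C' where C': "conj_transpose A ** C' ** conj_transpose A = conj_transpose A"
      "conj_transpose (conj_transpose A ** C') = conj_transpose A ** C'"
    using ex_hermitian_generalized_inverse by blast
  define C where "C = conj_transpose C'"
  have CA: "conj_transpose (C ** A) = C ** A"
    using C'(2) by (simp add: C_def conj_transpose_mult)
  have ACA: "A ** C ** A = A"
    using arg_cong[OF C'(1), of conj_transpose]
    by (simp add: C_def conj_transpose_mult matrix_mul_assoc)
  have l: "A ** (C ** A ** B) = A ** B"
    by (simp add: matrix_mul_assoc ACA)
  have r: "C ** A ** B ** A = C ** A"
    by (metis B(1) matrix_mul_assoc)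
  have "is_mp_inverse A (C ** A ** B)"
    unfolding is_mp_inverse_def l r
    using B CA by (metis ACA matrix_mul_assoc)
  then show ?thesis ..
qed

text \<open>Taking adjoints reverses a product of Hermitian factors, so
  \<open>A X = (A Y)(A X)\<close> turns into \<open>(A X)(A Y) = A Y\<close>; likewise
  \<open>X A = Y A\<close>. Then \<open>X = X A X = Y A X = Y A Y = Y\<close>.\<close>

lemma is_mp_inverse_unique:
  assumes X: "is_mp_inverse A X" and Y: "is_mp_inverse A Y"
  shows "X = Y"
proof -
  have "A ** X = conj_transpose (A ** Y ** A ** X)"
    using X Y by (simp add: is_mp_inverse_def)
  also have "\<dots> = conj_transpose (A ** X) ** conj_transpose (A ** Y)"
    by (simp add: conj_transpose_mult[symmetric] matrix_mul_assoc)
  also have "\<dots> = A ** Y"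
    using X Y by (simp add: is_mp_inverse_def matrix_mul_assoc)
  finally have AX: "A ** X = A ** Y" .
  have "X ** A = conj_transpose (X ** A ** (Y ** A))"
    using X Y by (metis is_mp_inverse_def matrix_mul_assoc)
  also have "\<dots> = conj_transpose (Y ** A) ** conj_transpose (X ** A)"
    by (rule conj_transpose_mult)
  also have "\<dots> = Y ** A"
    using X Y by (metis is_mp_inverse_def matrix_mul_assoc)
  finally have "X ** A = Y ** A" .
  with AX show ?thesis
    using X Y by (metis is_mp_inverse_def matrix_mul_assoc)
qed

lemma mp_inverse_eqI: "is_mp_inverse A X \<Longrightarrow> mp_inverse A = X"
  unfolding mp_inverse_def using is_mp_inverse_unique by blast

lemma is_mp_inverse_mp_inverse:
  fixes A :: "'a::conjugatable_ordered_field^'n^'m"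
  shows "is_mp_inverse A (mp_inverse A)"
  using ex_mp_inverse mp_inverse_eqI by metis

section \<open>Moore-Penrose inverses of orthogonal sums\<close>

lemma is_mp_inverse_conj_transpose:
  assumes "is_mp_inverse A X"
  shows "is_mp_inverse (conj_transpose A) (conj_transpose X)"
  using assms unfolding is_mp_inverse_def
  by (metis conj_transpose_invol conj_transpose_mult matrix_mul_assoc)

text \<open>Since \<open>A X\<close> is Hermitian, \<open>X = X (A X)* = X X* A*\<close>, so
  \<open>X B\<close> contains the factor \<open>A* B\<close>.\<close>

lemma mp_inverse_mult_eq_zero:
  assumes "is_mp_inverse A X" "conj_transpose A ** B = 0"
  shows "X ** B = 0"
proof -
  have "X ** B = X ** conj_transpose (A ** X) ** B"
    using assms(1) by (simp add: is_mp_inverse_def matrix_mul_assoc)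
  also have "\<dots> = X ** conj_transpose X ** (conj_transpose A ** B)"
    by (simp add: conj_transpose_mult matrix_mul_assoc)
  finally show ?thesis
    by (simp add: assms(2))
qed

text \<open>This is the adjoint of the preceding fact, applied to \<open>A*\<close> and
  \<open>X*\<close>.\<close>

lemma mult_mp_inverse_eq_zero:
  assumes "is_mp_inverse A X" "B ** conj_transpose A = 0"
  shows "B ** X = 0"
proof -
  have "conj_transpose X ** conj_transpose B = 0"
    using assms(2) by (intro mp_inverse_mult_eq_zero[OF is_mp_inverse_conj_transpose[OF assms(1)]])
      (metis conj_transpose_mult conj_transpose_zero conj_transpose_invol)
  then show ?thesis
    by (metis conj_transpose_mult conj_transpose_zero conj_transpose_invol)
qed

lemma is_mp_inverse_add:
  assumes X: "is_mp_inverse A X" and E: "is_mp_inverse D E"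
    and AD: "A ** conj_transpose D = 0" and DA: "conj_transpose A ** D = 0"
  shows "is_mp_inverse (A + D) (X + E)"
proof -
  \<comment> \<open>The adjoint forms let the pairs \<open>(A, X)\<close> and \<open>(D, E)\<close>
    exchange roles below.\<close>
  have AD': "D ** conj_transpose A = 0" and DA': "conj_transpose D ** A = 0"
    by (metis AD conj_transpose_invol conj_transpose_mult conj_transpose_zero,
        metis DA conj_transpose_invol conj_transpose_mult conj_transpose_zero)
  have zero: "A ** E = 0" "E ** A = 0" "D ** X = 0" "X ** D = 0"
    using mult_mp_inverse_eq_zero[OF E AD] mp_inverse_mult_eq_zero[OF E DA']
      mult_mp_inverse_eq_zero[OF X AD'] mp_inverse_mult_eq_zero[OF X DA] by auto
  have prods: "(A + D) ** (X + E) = A ** X + D ** E" "(X + E) ** (A + D) = X ** A + E ** D"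
    by (simp_all add: matrix_add_ldistrib matrix_add_rdistrib zero)
  \<comment> \<open>Expanding the Penrose equations gives products bracketed to the left, which the
    two-factor rules in \<open>zero\<close> do not match.\<close>
  have zero3: "A ** X ** D = 0" "D ** E ** A = 0" "X ** A ** E = 0" "E ** D ** X = 0"
    by (simp_all add: zero matrix_mul_assoc[symmetric])
  show ?thesis
    using X E unfolding is_mp_inverse_def prods
    by (simp add: matrix_add_ldistrib matrix_add_rdistrib zero3 conj_transpose_add)
qed

section \<open>The rank-one sums and the final formula\<close>

lemma is_mp_inverse_outer_sum:
  assumes "orthonormal_family I f" "orthonormal_family I g" "finite I"
    and d: "\<And>k. k \<in> I \<Longrightarrow> d k \<noteq> 0"
  shows "is_mp_inverse (\<Sum>k\<in>I. d k *\<^sub>m outer (g k) (f k)) (\<Sum>k\<in>I. (1 / d k) *\<^sub>m outer (f k) (g k))"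
    (is "is_mp_inverse ?D ?E")
proof -
  \<comment> \<open>The products are the orthogonal projections onto the spans of the
    \<open>g k\<close> and of the \<open>f k\<close>. The coefficient 1 is kept so that
    \<open>outer_sum_mult_outer_sum\<close> applies again to the triple products.\<close>
  have DE: "?D ** ?E = (\<Sum>k\<in>I. 1 *\<^sub>m outer (g k) (g k))"
    using assms by (auto simp: outer_sum_mult_outer_sum intro!: sum.cong)
  have ED: "?E ** ?D = (\<Sum>k\<in>I. 1 *\<^sub>m outer (f k) (f k))"
    using assms by (auto simp: outer_sum_mult_outer_sum intro!: sum.cong)
  show ?thesis
    unfolding is_mp_inverse_def DE ED
    using assms(1-3) by (simp only: outer_sum_mult_outer_sum)
      (simp add: conj_transpose_sum)
qed

text \<open>The class \<open>conjugatable_ordered_field\<close> contains both \<open>real\<close>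
  and \<open>complex\<close>, so one argument serves both halves of the theorem.\<close>

lemma mp_inverse_add_outer_sum:
  fixes A :: "'a::conjugatable_ordered_field^'n^'m"
  assumes "orthonormal_family I f" "orthonormal_family I g" "finite I"
    and f: "\<forall>k\<in>I. f k \<in> null_space A"
    and g: "\<forall>k\<in>I. g k \<in> null_space (conj_transpose A)"
    and d: "\<forall>k\<in>I. d k \<noteq> 0"
  shows "mp_inverse A = mp_inverse (A + (\<Sum>k\<in>I. d k *\<^sub>m outer (g k) (f k)))
    - (\<Sum>k\<in>I. (1 / d k) *\<^sub>m outer (f k) (g k))"
proof -
  let ?D = "\<Sum>k\<in>I. d k *\<^sub>m outer (g k) (f k)"
  have "conj_transpose (c *\<^sub>m outer x y) = conjugate c *\<^sub>m outer y x" for c and x :: "'a^'m" and y :: "'a^'n"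
    by (simp add: conj_transpose_def mat_scale_def outer_nth vec_eq_iff conjugate_dist_mul mult_ac)
  \<comment> \<open>The adjoint of \<open>?D\<close> is a combination of the
    \<open>f k (g k)*\<close>, and \<open>A\<close> annihilates each \<open>f k\<close>.\<close>
  then have "A ** conj_transpose ?D = 0"
    using f by (simp add: conj_transpose_sum matrix_sum_ldistrib mat_scale_mult_right
        mult_outer_null_space)
  moreover have "conj_transpose A ** ?D = 0"
    using g by (simp add: matrix_sum_ldistrib mat_scale_mult_right mult_outer_null_space)
  ultimately have "is_mp_inverse (A + ?D) (mp_inverse A + (\<Sum>k\<in>I. (1 / d k) *\<^sub>m outer (f k) (g k)))"
    using assms by (intro is_mp_inverse_add is_mp_inverse_mp_inverse is_mp_inverse_outer_sum) auto
  then show ?thesis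
    by (simp add: mp_inverse_eqI)
qed

theorem theorem3p1:
  shows
   "(\<forall>(A :: real^'n^'m) (q' :: nat)
        (f :: nat \<Rightarrow> real^'n) (g :: nat \<Rightarrow> real^'m) (d :: nat \<Rightarrow> real).
      rank A \<le> q' \<longrightarrow> q' \<le> min CARD('m) CARD('n) \<longrightarrow>
      orthonormal_family {1..q' - rank A} f \<longrightarrow>
      (\<forall>k\<in>{1..q' - rank A}. f k \<in> null_space A) \<longrightarrow>
      orthonormal_family {1..q' - rank A} g \<longrightarrow>
      (\<forall>k\<in>{1..q' - rank A}. g k \<in> null_space (conj_transpose A)) \<longrightarrow>
      (\<forall>k\<in>{1..q' - rank A}. d k \<noteq> 0) \<longrightarrow>
      mp_inverse A =
        mp_inverse (A + (\<Sum>k = 1..q' - rank A. d k *\<^sub>m outer (g k) (f k)))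
        - (\<Sum>k = 1..q' - rank A. (1 / d k) *\<^sub>m outer (f k) (g k)))
    \<and>
    (\<forall>(A :: complex^'n^'m) (q' :: nat)
        (f :: nat \<Rightarrow> complex^'n) (g :: nat \<Rightarrow> complex^'m) (d :: nat \<Rightarrow> complex).
      rank A \<le> q' \<longrightarrow> q' \<le> min CARD('m) CARD('n) \<longrightarrow>
      orthonormal_family {1..q' - rank A} f \<longrightarrow>
      (\<forall>k\<in>{1..q' - rank A}. f k \<in> null_space A) \<longrightarrow>
      orthonormal_family {1..q' - rank A} g \<longrightarrow>
      (\<forall>k\<in>{1..q' - rank A}. g k \<in> null_space (conj_transpose A)) \<longrightarrow>
      (\<forall>k\<in>{1..q' - rank A}. d k \<noteq> 0) \<longrightarrow>
      mp_inverse A =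
        mp_inverse (A + (\<Sum>k = 1..q' - rank A. d k *\<^sub>m outer (g k) (f k)))
        - (\<Sum>k = 1..q' - rank A. (1 / d k) *\<^sub>m outer (f k) (g k)))"
  by (intro conjI allI impI mp_inverse_add_outer_sum) auto

end
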